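(* Let $\{pt\}$ be a one-point metric space. Then $H_n^{lc}(\{pt\})=0$ for all $n>0$.
   Context: Given $\epsilon>0$, a map $g:X\to Y$ between metric spaces is $\epsilon$-continuous if there exists $\delta>0$ such that $\sup\{d_Y(g(x_1),g(x_2)) : d_X(x_1,x_2)<\delta\}<\epsilon$. Let $\Delta^n\subset\mathbb{R}^{n+1}$ be the standard $n$-simplex with its Euclidean metric. An $\epsilon$-singular $n$-simplex of $X$ is an $\epsilon$-continuous map $\sigma:\Delta^n\to X$. $C_n^{\epsilon}(X)$ is the free abelian group on all $\epsilon$-singular $n$-simplices, with the usual singular boundary operator $\partial_n\sigma=\sum_{i=0}^n(-1)^i\sigma|[v_0,\dots,\hat v_i,\dots,v_n]$, and $H_n^{\epsilon}(X)=\ker\partial_n/\operatorname{im}\partial_{n+1}$. For $0<\mu\le\epsilon$ the inclusion $C_*^{\mu}(X)\hookrightarrow C_*^{\epsilon}(X)$ is a chain map and induces $\varphi_{\mu\epsilon*}:H_n^{\mu}(X)\to H_n^{\epsilon}(X)$. The $n$-th $lc$-homology group is the inverse limit $H_n^{lc}(X)=\varprojlim_{\epsilon>0}H_n^{\epsilon}(X)$ along these maps. *)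

theory Defs
  imports "HOL-Analysis.Analysis" "HOL-Homology.Homology"
begin

section \<open>Epsilon-continuous maps\<close>

text \<open>The supremum is taken in \<^typ>\<open>ereal\<close>, so that it is \<open>\<infinity>\<close> on an unbounded set of distances.\<close>

definition eps_continuous_map :: "real \<Rightarrow> 'a metric \<Rightarrow> 'b metric \<Rightarrow> ('a \<Rightarrow> 'b) \<Rightarrow> bool" where
  "eps_continuous_map \<epsilon> X Y g \<longleftrightarrow>
     g \<in> mspace X \<rightarrow> mspace Y \<and>
     (\<exists>\<delta>>0. Sup {ereal (mdist Y (g x1) (g x2)) | x1 x2.
                  x1 \<in> mspace X \<and> x2 \<in> mspace X \<and> mdist X x1 x2 < \<delta>} < ereal \<epsilon>)"

lemma eps_continuous_map_mono:
  assumes "eps_continuous_map \<mu> X Y g" "\<mu> \<le> \<epsilon>"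
  shows "eps_continuous_map \<epsilon> X Y g"
  using assms unfolding eps_continuous_map_def by (meson ereal_less_eq(3) less_le_trans)


section \<open>The standard simplex with its Euclidean metric\<close>

text \<open>Points of \<^term>\<open>standard_simplex n\<close> are functions on \<^typ>\<open>nat\<close> that vanish
  beyond \<open>n\<close>; their first \<open>n + 1\<close> values are the coordinates in Euclidean \<open>(n + 1)\<close>-space.\<close>

definition simplex_metric :: "nat \<Rightarrow> (nat \<Rightarrow> real) metric" where
  "simplex_metric n = metric (standard_simplex n, \<lambda>x y. L2_set (\<lambda>i. x i - y i) {..n})"

lemma Metric_space_standard_simplex:
  "Metric_space (standard_simplex n) (\<lambda>x y. L2_set (\<lambda>i. x i - y i) {..n})"
proof
  fix x y z :: "nat \<Rightarrow> real"
  show "0 \<le> L2_set (\<lambda>i. x i - y i) {..n}"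
    by (rule L2_set_nonneg)
  show "L2_set (\<lambda>i. x i - y i) {..n} = L2_set (\<lambda>i. y i - x i) {..n}"
    by (simp add: L2_set_def power2_commute)
  show "L2_set (\<lambda>i. x i - y i) {..n} = 0 \<longleftrightarrow> x = y"
    if "x \<in> standard_simplex n" "y \<in> standard_simplex n"
  proof -
    have "x i = y i" if "\<forall>i\<le>n. x i = y i" for i
      using that \<open>x \<in> _\<close> \<open>y \<in> _\<close> by (cases "i \<le> n") (auto simp: standard_simplex_def)
    then show ?thesis
      by (auto simp: L2_set_eq_0_iff)
  qed
  show "L2_set (\<lambda>i. x i - z i) {..n} \<le> L2_set (\<lambda>i. x i - y i) {..n} + L2_set (\<lambda>i. y i - z i) {..n}"
    using L2_set_triangle_ineq [of "\<lambda>i. x i - y i" "\<lambda>i. y i - z i" "{..n}"] by simp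
qed

lemma mspace_simplex_metric [simp]: "mspace (simplex_metric n) = standard_simplex n"
  by (simp add: simplex_metric_def Metric_space.mspace_metric [OF Metric_space_standard_simplex])

lemma mdist_simplex_metric [simp]:
  "mdist (simplex_metric n) x y = L2_set (\<lambda>i. x i - y i) {..n}"
  by (simp add: simplex_metric_def Metric_space.mdist_metric [OF Metric_space_standard_simplex])


section \<open>Epsilon-singular chains and their homology\<close>

text \<open>As with \<^const>\<open>singular_simplex\<close>, simplices are normalised to be \<^const>\<open>undefined\<close>
  outside \<^const>\<open>standard_simplex\<close>, so that distinct terms are distinct maps.\<close>

definition eps_singular_simplex :: "real \<Rightarrow> nat \<Rightarrow> 'a metric \<Rightarrow> ((nat \<Rightarrow> real) \<Rightarrow> 'a) \<Rightarrow> bool" where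
  "eps_singular_simplex \<epsilon> n X \<sigma> \<longleftrightarrow>
     eps_continuous_map \<epsilon> (simplex_metric n) X \<sigma> \<and> \<sigma> \<in> extensional (standard_simplex n)"

definition eps_chain_group :: "real \<Rightarrow> nat \<Rightarrow> 'a metric \<Rightarrow> 'a chain monoid" where
  "eps_chain_group \<epsilon> n X = free_Abelian_group {\<sigma>. eps_singular_simplex \<epsilon> n X \<sigma>}"

text \<open>The boundary operator is the library's \<^const>\<open>chain_boundary\<close>, which does not refer to a
  topology. It is zero on \<open>0\<close>-chains.\<close>

definition eps_cycles :: "real \<Rightarrow> nat \<Rightarrow> 'a metric \<Rightarrow> 'a chain set" where
  "eps_cycles \<epsilon> n X = {c \<in> carrier (eps_chain_group \<epsilon> n X). chain_boundary n c = 0}"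

definition eps_boundaries :: "real \<Rightarrow> nat \<Rightarrow> 'a metric \<Rightarrow> 'a chain set" where
  "eps_boundaries \<epsilon> n X = chain_boundary (Suc n) ` carrier (eps_chain_group \<epsilon> (Suc n) X)"

definition eps_cycle_group :: "real \<Rightarrow> nat \<Rightarrow> 'a metric \<Rightarrow> 'a chain monoid" where
  "eps_cycle_group \<epsilon> n X = (eps_chain_group \<epsilon> n X)\<lparr>carrier := eps_cycles \<epsilon> n X\<rparr>"

definition eps_homology_group :: "real \<Rightarrow> nat \<Rightarrow> 'a metric \<Rightarrow> 'a chain set monoid" where
  "eps_homology_group \<epsilon> n X = eps_cycle_group \<epsilon> n X Mod eps_boundaries \<epsilon> n X"

text \<open>The map induced by the inclusion of \<open>\<mu>\<close>-chains into \<open>\<epsilon>\<close>-chains sends the class of a cycle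
  \<open>c\<close> to the class of \<open>c\<close>: the image below is a singleton whenever \<open>z\<close> is a homology class.\<close>

definition eps_homology_map ::
    "nat \<Rightarrow> 'a metric \<Rightarrow> real \<Rightarrow> real \<Rightarrow> 'a chain set \<Rightarrow> 'a chain set" where
  "eps_homology_map n X \<mu> \<epsilon> z =
     the_elem ((\<lambda>c. eps_boundaries \<epsilon> n X #>\<^bsub>eps_cycle_group \<epsilon> n X\<^esub> c) ` z)"


section \<open>Inverse limits and lc-homology\<close>

text \<open>The transition map \<open>f i j\<close> goes from \<open>G i\<close> to \<open>G j\<close> for \<open>i \<le> j\<close>, so the limit is taken
  towards smaller indices.\<close>

definition inverse_limit_group ::
    "'i::order set \<Rightarrow> ('i \<Rightarrow> 'b monoid) \<Rightarrow> ('i \<Rightarrow> 'i \<Rightarrow> 'b \<Rightarrow> 'b) \<Rightarrow> ('i \<Rightarrow> 'b) monoid" where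
  "inverse_limit_group I G f = (product_group I G)
     \<lparr>carrier := {x \<in> carrier (product_group I G). \<forall>i\<in>I. \<forall>j\<in>I. i \<le> j \<longrightarrow> f i j (x i) = x j}\<rparr>"

definition lc_homology_group :: "nat \<Rightarrow> 'a metric \<Rightarrow> (real \<Rightarrow> 'a chain set) monoid" where
  "lc_homology_group n X =
     inverse_limit_group {0<..} (\<lambda>\<epsilon>. eps_homology_group \<epsilon> n X) (eps_homology_map n X)"


section \<open>Well-definedness\<close>

lemma carrier_eps_chain_group:
  "c \<in> carrier (eps_chain_group \<epsilon> n X) \<longleftrightarrow> Poly_Mapping.keys c \<subseteq> {\<sigma>. eps_singular_simplex \<epsilon> n X \<sigma>}"
  by (simp add: eps_chain_group_def free_Abelian_group_def)

lemma L2_set_simplical_face: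
  assumes "k \<le> Suc n"
  shows "L2_set (\<lambda>i. simplical_face k x i - simplical_face k y i) {..Suc n}
       = L2_set (\<lambda>i. x i - y i) {..n}"
proof -
  have eq: "{..Suc n} = insert k ({..<k} \<union> Suc ` {k..n})" (is "_ = insert k (?A \<union> ?B)")
  proof -
    have "i \<in> Suc ` {k..n}" if "k < i" "i \<le> Suc n" for i
      using that by (cases i) auto
    then have "i \<in> insert k (?A \<union> ?B)" if "i \<le> Suc n" for i
      using that by (cases i k rule: linorder_cases) auto
    then show ?thesis using assms by auto
  qed
  have disj: "?A \<inter> ?B = {}" "k \<notin> ?A \<union> ?B" by auto
  have "(\<Sum>i\<le>Suc n. (simplical_face k x i - simplical_face k y i)\<^sup>2)
      = (\<Sum>i\<in>?A. (simplical_face k x i - simplical_face k y i)\<^sup>2)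
      + (\<Sum>i\<in>?B. (simplical_face k x i - simplical_face k y i)\<^sup>2)"
  proof -
    have "simplical_face k x k - simplical_face k y k = 0" by (simp add: simplical_face_def)
    then show ?thesis
      unfolding eq using disj
      by (simp add: sum.union_disjoint del: image_Suc_atLeastAtMost)
  qed
  also have "\<dots> = (\<Sum>i<k. (x i - y i)\<^sup>2) + (\<Sum>i\<in>{k..n}. (x i - y i)\<^sup>2)"
    by (simp add: sum.reindex simplical_face_def del: image_Suc_atLeastAtMost)
  also have "\<dots> = (\<Sum>i\<in>{..<k} \<union> {k..n}. (x i - y i)\<^sup>2)"
    by (rule sum.union_disjoint [symmetric]) auto
  also have "{..<k} \<union> {k..n} = {..n}" using assms by auto
  finally show ?thesis by (simp add: L2_set_def)
qed

lemma eps_singular_simplex_face: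
  assumes "eps_singular_simplex \<epsilon> (Suc n) X \<sigma>" "k \<le> Suc n"
  shows "eps_singular_simplex \<epsilon> n X (singular_face (Suc n) k \<sigma>)"
proof -
  have face: "simplical_face k x \<in> standard_simplex (Suc n)" if "x \<in> standard_simplex n" for x
    using simplical_face_in_standard_simplex [of "Suc n" k x] that assms(2) by simp
  let ?S = "\<lambda>\<delta>. {ereal (mdist X (\<sigma> x) (\<sigma> y)) | x y.
      x \<in> standard_simplex (Suc n) \<and> y \<in> standard_simplex (Suc n) \<and>
      L2_set (\<lambda>i. x i - y i) {..Suc n} < \<delta>}"
  let ?f = "singular_face (Suc n) k \<sigma>"
  let ?T = "\<lambda>\<delta>. {ereal (mdist X (?f x) (?f y)) | x y.
      x \<in> standard_simplex n \<and> y \<in> standard_simplex n \<and> L2_set (\<lambda>i. x i - y i) {..n} < \<delta>}"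
  from assms obtain \<delta> where \<delta>: "\<delta> > 0" "Sup (?S \<delta>) < ereal \<epsilon>"
    and \<sigma>: "\<sigma> \<in> standard_simplex (Suc n) \<rightarrow> mspace X"
    by (auto simp: eps_singular_simplex_def eps_continuous_map_def)
  have "?T \<delta> \<subseteq> ?S \<delta>"
  proof
    fix r assume "r \<in> ?T \<delta>"
    then obtain x y where "r = ereal (mdist X (?f x) (?f y))" "x \<in> standard_simplex n"
      "y \<in> standard_simplex n" "L2_set (\<lambda>i. x i - y i) {..n} < \<delta>" by blast
    then show "r \<in> ?S \<delta>"
      using face L2_set_simplical_face [OF assms(2)]
      unfolding mem_Collect_eq
      by (intro exI [of _ "simplical_face k x"] exI [of _ "simplical_face k y"])
         (simp add: singular_face_def)
  qed
  then have "Sup (?T \<delta>) < ereal \<epsilon>"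
    using \<delta>(2) Sup_subset_mono le_less_trans by blast
  moreover have "?f \<in> standard_simplex n \<rightarrow> mspace X"
    using face \<sigma> by (auto simp: singular_face_def)
  moreover have "?f \<in> extensional (standard_simplex n)"
    by (simp add: singular_face_def)
  ultimately show ?thesis
    using \<delta>(1) unfolding eps_singular_simplex_def eps_continuous_map_def
    by auto
qed

lemma chain_boundary_eps_chain:
  assumes "c \<in> carrier (eps_chain_group \<epsilon> (Suc n) X)"
  shows "chain_boundary (Suc n) c \<in> carrier (eps_chain_group \<epsilon> n X)"
proof -
  have "Poly_Mapping.keys (frag_extend
      (\<lambda>f. \<Sum>k\<le>Suc n. frag_cmul ((-1) ^ k) (frag_of (singular_face (Suc n) k f))) c)
    \<subseteq> {\<sigma>. eps_singular_simplex \<epsilon> n X \<sigma>}"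
  proof (rule order_trans [OF keys_frag_extend], rule UN_least)
    fix f assume "f \<in> Poly_Mapping.keys c"
    with assms have f: "eps_singular_simplex \<epsilon> (Suc n) X f"
      by (auto simp: carrier_eps_chain_group)
    show "Poly_Mapping.keys (\<Sum>k\<le>Suc n. frag_cmul ((-1) ^ k) (frag_of (singular_face (Suc n) k f)))
      \<subseteq> {\<sigma>. eps_singular_simplex \<epsilon> n X \<sigma>}"
      by (rule order_trans [OF keys_sum], rule UN_least, rule order_trans [OF keys_cmul])
         (use f eps_singular_simplex_face in auto)
  qed
  then show ?thesis by (simp add: carrier_eps_chain_group chain_boundary_def)
qed

text \<open>A chain of arbitrary functions is a singular chain of the indiscrete space, whence
  \<open>\<partial>\<partial> = 0\<close>.\<close>

lemma chain_boundary_boundary_eps: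
  assumes "c \<in> carrier (eps_chain_group \<epsilon> (Suc n) X)"
  shows "chain_boundary n (chain_boundary (Suc n) c) = 0"
proof -
  let ?I = "topology_generated_by {UNIV :: 'a set}"
  have "openin ?I U \<Longrightarrow> U = {} \<or> U = UNIV" for U
    unfolding openin_topology_generated_by_iff
    by (induction rule: generate_topology_on.induct) auto
  then have "openin Y {x \<in> topspace Y. f x \<in> U}" if "openin ?I U" for U
    and Y :: "(nat \<Rightarrow> real) topology" and f
    using that by fastforce
  then have "continuous_map Y ?I f" for Y :: "(nat \<Rightarrow> real) topology" and f
    unfolding continuous_map_def by (auto simp: topology_generated_by_topspace)
  then have "singular_chain (Suc n) ?I c"
    using assms by (auto simp: carrier_eps_chain_group singular_chain_def singular_simplex_def
        eps_singular_simplex_def)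
  then show ?thesis by (rule chain_boundary_boundary_alt)
qed

lemma comm_group_eps_chain_group: "comm_group (eps_chain_group \<epsilon> n X)"
  by (simp add: eps_chain_group_def abelian_free_Abelian_group)

lemma subgroup_eps_chain_groupI:
  assumes "S \<subseteq> carrier (eps_chain_group \<epsilon> n X)" "0 \<in> S"
    "\<And>x y. x \<in> S \<Longrightarrow> y \<in> S \<Longrightarrow> x + y \<in> S" "\<And>x. x \<in> S \<Longrightarrow> - x \<in> S"
  shows "subgroup S (eps_chain_group \<epsilon> n X)"
proof -
  interpret group "eps_chain_group \<epsilon> n X"
    by (rule comm_group.axioms(2) [OF comm_group_eps_chain_group])
  have "inv\<^bsub>eps_chain_group \<epsilon> n X\<^esub> x = - x" if "x \<in> S" for x
    using that assms(1) by (auto simp: eps_chain_group_def)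
  then show ?thesis
    using assms by (intro subgroupI) (auto simp: eps_chain_group_def)
qed

lemma eps_chain_add:
  "\<lbrakk>x \<in> carrier (eps_chain_group \<epsilon> n X); y \<in> carrier (eps_chain_group \<epsilon> n X)\<rbrakk>
    \<Longrightarrow> x + y \<in> carrier (eps_chain_group \<epsilon> n X)"
  using keys_add [of x y] by (auto simp: carrier_eps_chain_group)

lemma eps_chain_minus:
  "x \<in> carrier (eps_chain_group \<epsilon> n X) \<Longrightarrow> - x \<in> carrier (eps_chain_group \<epsilon> n X)"
  by (simp add: carrier_eps_chain_group)

lemma eps_chain_zero: "0 \<in> carrier (eps_chain_group \<epsilon> n X)"
  by (simp add: carrier_eps_chain_group)

lemma subgroup_eps_cycles: "subgroup (eps_cycles \<epsilon> n X) (eps_chain_group \<epsilon> n X)"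
  by (rule subgroup_eps_chain_groupI)
     (auto simp: eps_cycles_def eps_chain_add eps_chain_minus eps_chain_zero chain_boundary_add
        chain_boundary_minus)

lemma subgroup_eps_boundaries: "subgroup (eps_boundaries \<epsilon> n X) (eps_chain_group \<epsilon> n X)"
proof (rule subgroup_eps_chain_groupI)
  show "eps_boundaries \<epsilon> n X \<subseteq> carrier (eps_chain_group \<epsilon> n X)"
    by (auto simp: eps_boundaries_def chain_boundary_eps_chain)
  show "0 \<in> eps_boundaries \<epsilon> n X"
    unfolding eps_boundaries_def by (rule image_eqI [of _ _ 0]) (auto simp: carrier_eps_chain_group)
  show "x + y \<in> eps_boundaries \<epsilon> n X"
    if "x \<in> eps_boundaries \<epsilon> n X" "y \<in> eps_boundaries \<epsilon> n X" for x y
    using that unfolding eps_boundaries_def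
    by (auto simp flip: chain_boundary_add intro: eps_chain_add)
  show "- x \<in> eps_boundaries \<epsilon> n X" if "x \<in> eps_boundaries \<epsilon> n X" for x
    using that unfolding eps_boundaries_def
    by (auto simp flip: chain_boundary_minus intro: eps_chain_minus)
qed

lemma eps_boundaries_subset_cycles: "eps_boundaries \<epsilon> n X \<subseteq> eps_cycles \<epsilon> n X"
  by (auto simp: eps_boundaries_def eps_cycles_def chain_boundary_eps_chain
      chain_boundary_boundary_eps)

lemma comm_group_eps_cycle_group: "comm_group (eps_cycle_group \<epsilon> n X)"
proof -
  interpret C: comm_group "eps_chain_group \<epsilon> n X" by (rule comm_group_eps_chain_group)
  show ?thesis
    unfolding eps_cycle_group_def
    by (rule group.group_comm_groupI [OF C.subgroup_imp_group [OF subgroup_eps_cycles]])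
       (auto simp: eps_cycles_def C.m_comm)
qed

lemma subgroup_eps_boundaries_cycle_group:
  "subgroup (eps_boundaries \<epsilon> n X) (eps_cycle_group \<epsilon> n X)"
  unfolding eps_cycle_group_def
  using group.subgroup_incl [OF comm_group.axioms(2) [OF comm_group_eps_chain_group]
      subgroup_eps_boundaries subgroup_eps_cycles eps_boundaries_subset_cycles] .

lemma comm_group_eps_homology_group: "comm_group (eps_homology_group \<epsilon> n X)"
  unfolding eps_homology_group_def
  by (rule comm_group.abelian_FactGroup [OF comm_group_eps_cycle_group
      subgroup_eps_boundaries_cycle_group])

lemma eps_chain_group_mono:
  assumes "\<mu> \<le> \<epsilon>"
  shows "carrier (eps_chain_group \<mu> n X) \<subseteq> carrier (eps_chain_group \<epsilon> n X)"
  using assms eps_continuous_map_mono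
  by (fastforce simp: carrier_eps_chain_group eps_singular_simplex_def)

lemma eps_cycles_mono: "\<mu> \<le> \<epsilon> \<Longrightarrow> eps_cycles \<mu> n X \<subseteq> eps_cycles \<epsilon> n X"
  using eps_chain_group_mono by (fastforce simp: eps_cycles_def)

lemma eps_boundaries_mono: "\<mu> \<le> \<epsilon> \<Longrightarrow> eps_boundaries \<mu> n X \<subseteq> eps_boundaries \<epsilon> n X"
  unfolding eps_boundaries_def by (intro image_mono eps_chain_group_mono)

lemma eps_homology_map_class:
  assumes "\<mu> \<le> \<epsilon>" "c \<in> eps_cycles \<mu> n X"
  shows "eps_homology_map n X \<mu> \<epsilon> (eps_boundaries \<mu> n X #>\<^bsub>eps_cycle_group \<mu> n X\<^esub> c)
       = eps_boundaries \<epsilon> n X #>\<^bsub>eps_cycle_group \<epsilon> n X\<^esub> c"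
proof -
  interpret E: comm_group "eps_cycle_group \<epsilon> n X" by (rule comm_group_eps_cycle_group)
  interpret M: comm_group "eps_cycle_group \<mu> n X" by (rule comm_group_eps_cycle_group)
  note sub = subgroup_eps_boundaries_cycle_group
  have car [simp]: "carrier (eps_cycle_group e n X) = eps_cycles e n X" for e
    by (simp add: eps_cycle_group_def)
  have mult [simp]: "x \<otimes>\<^bsub>eps_cycle_group e n X\<^esub> y = x + y" for x y e
    by (simp add: eps_cycle_group_def eps_chain_group_def)
  have c: "c \<in> eps_cycles \<epsilon> n X" using assms eps_cycles_mono by blast
  have "eps_boundaries \<epsilon> n X #>\<^bsub>eps_cycle_group \<epsilon> n X\<^esub> c' =
        eps_boundaries \<epsilon> n X #>\<^bsub>eps_cycle_group \<epsilon> n X\<^esub> c"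
    if "c' \<in> eps_boundaries \<mu> n X #>\<^bsub>eps_cycle_group \<mu> n X\<^esub> c" for c'
  proof -
    from that have "c' \<in> eps_boundaries \<epsilon> n X #>\<^bsub>eps_cycle_group \<epsilon> n X\<^esub> c"
      using eps_boundaries_mono [OF assms(1)] by (auto simp: r_coset_def)
    then show ?thesis
      using E.repr_independence [OF _ _ sub] c by (metis car)
  qed
  moreover have "c \<in> eps_boundaries \<mu> n X #>\<^bsub>eps_cycle_group \<mu> n X\<^esub> c"
    using M.rcos_self [OF _ sub] assms(2) by simp
  ultimately have "(\<lambda>c. eps_boundaries \<epsilon> n X #>\<^bsub>eps_cycle_group \<epsilon> n X\<^esub> c) `
      (eps_boundaries \<mu> n X #>\<^bsub>eps_cycle_group \<mu> n X\<^esub> c)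
    = {eps_boundaries \<epsilon> n X #>\<^bsub>eps_cycle_group \<epsilon> n X\<^esub> c}" by blast
  then show ?thesis by (simp add: eps_homology_map_def)
qed

end

theory Submission
  imports Defs
begin

text \<open>
  A map into a one-point space has constant distance \<open>0\<close> between its values, so it is
  \<open>\<epsilon>\<close>-continuous for every \<open>\<epsilon> > 0\<close>; it is also continuous in the ordinary sense. The
  \<open>\<epsilon>\<close>-singular simplices of a point are therefore its ordinary singular simplices
  (\<open>eps_singular_simplex_singleton\<close>). Chains, boundary operator, cycles and boundaries use nothing
  about the space except its simplices, so the \<open>\<epsilon>\<close>-homology groups are the ordinary singular
  homology groups (\<open>eps_homology_group_eq_homology_group\<close>), and these vanish in positive degrees
  by the dimension axiom. An inverse limit of trivial groups is trivial
  (\<open>trivial_inverse_limit_group\<close>) because it lies in their product and contains the identity of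
  that product.
\<close>

text \<open>The extended real \<open>Sup\<close> in the definition of \<open>\<epsilon>\<close>-continuity ranges over a subset of \<open>{0}\<close>,
  so it is at most \<open>0\<close> for any choice of \<open>\<delta>\<close>.\<close>

lemma eps_continuous_map_singleton:
  assumes "mspace Y = {a}" and "\<epsilon> > 0"
  shows "eps_continuous_map \<epsilon> X Y g \<longleftrightarrow> g \<in> mspace X \<rightarrow> {a}"
proof -
  have "Sup {ereal (mdist Y (g x1) (g x2)) | x1 x2.
          x1 \<in> mspace X \<and> x2 \<in> mspace X \<and> mdist X x1 x2 < 1} < ereal \<epsilon>" (is "Sup ?D < _")
    if "g \<in> mspace X \<rightarrow> {a}"
  proof -
    have "mdist Y (g x1) (g x2) = 0" if "x1 \<in> mspace X" "x2 \<in> mspace X" for x1 x2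
    proof -
      have "g x1 = a" "g x2 = a" using \<open>g \<in> _\<close> that by auto
      then show ?thesis using assms(1) by simp
    qed
    then have "Sup ?D \<le> 0" by (intro Sup_least) auto
    then show ?thesis using assms(2) by (simp add: le_less_trans)
  qed
  then show ?thesis
    unfolding eps_continuous_map_def assms(1) by (meson zero_less_one)
qed

lemma eps_singular_simplex_singleton:
  assumes "mspace X = {pt}" and "\<epsilon> > 0"
  shows "eps_singular_simplex \<epsilon> n X \<sigma> \<longleftrightarrow> singular_simplex n (discrete_topology {pt}) \<sigma>"
proof -
  let ?S = "subtopology (powertop_real UNIV) (standard_simplex n)"
  have "openin ?S {x \<in> topspace ?S. \<sigma> x \<in> U}"
    if "\<sigma> \<in> topspace ?S \<rightarrow> {pt}" "U \<subseteq> {pt}" for U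
  proof -
    have "{x \<in> topspace ?S. \<sigma> x \<in> U} = (if U = {} then {} else topspace ?S)"
      using that by auto
    then show ?thesis by (metis openin_empty openin_topspace)
  qed
  then have "continuous_map ?S (discrete_topology {pt}) \<sigma> \<longleftrightarrow> \<sigma> \<in> standard_simplex n \<rightarrow> {pt}"
    unfolding continuous_map_def by auto
  then show ?thesis
    by (simp add: eps_singular_simplex_def singular_simplex_def
        eps_continuous_map_singleton [OF assms])
qed

text \<open>Agreement in degrees \<open>n\<close> and \<open>n + 1\<close> is enough: the former gives the cycles and the
  latter the boundaries of degree \<open>n\<close>.\<close>

lemma eps_homology_group_eq_homology_group:
  assumes "\<And>\<sigma>. eps_singular_simplex \<epsilon> n X \<sigma> \<longleftrightarrow> singular_simplex n T \<sigma>"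
    and "\<And>\<sigma>. eps_singular_simplex \<epsilon> (Suc n) X \<sigma> \<longleftrightarrow> singular_simplex (Suc n) T \<sigma>"
  shows "eps_homology_group \<epsilon> n X = homology_group (int n) T"
proof -
  have chains: "eps_chain_group \<epsilon> n X = chain_group n T"
      "eps_chain_group \<epsilon> (Suc n) X = chain_group (Suc n) T"
    by (simp_all add: eps_chain_group_def chain_group_def assms)
  have cycles: "eps_cycles \<epsilon> n X = singular_relcycle_set n T {}"
    by (auto simp: eps_cycles_def chains singular_cycle)
  have boundaries: "eps_boundaries \<epsilon> n X = singular_relboundary_set n T {}"
    by (auto simp: eps_boundaries_def chains singular_boundary)
  have "eps_cycle_group \<epsilon> n X = relcycle_group n T {}"
    by (rule monoid.equality)
       (simp_all add: eps_cycle_group_def chains cycles)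
  then show ?thesis
    by (simp add: eps_homology_group_def nontrivial_relative_homology_group boundaries)
qed

lemma trivial_eps_homology_group_singleton:
  assumes "mspace X = {pt}" and "\<epsilon> > 0" and "n > 0"
  shows "trivial_group (eps_homology_group \<epsilon> n X)"
  using eps_homology_group_eq_homology_group [OF eps_singular_simplex_singleton [OF assms(1,2)]
      eps_singular_simplex_singleton [OF assms(1,2)]]
  by (simp add: homology_dimension_axiom [of _ pt] assms(3))

text \<open>The identity of a homology group is the class of the cycle \<open>0\<close>.\<close>

lemma eps_homology_map_one:
  assumes "\<mu> \<le> \<epsilon>"
  shows "eps_homology_map n X \<mu> \<epsilon> \<one>\<^bsub>eps_homology_group \<mu> n X\<^esub> = \<one>\<^bsub>eps_homology_group \<epsilon> n X\<^esub>"
proof -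
  have one: "\<one>\<^bsub>eps_homology_group e n X\<^esub> = eps_boundaries e n X #>\<^bsub>eps_cycle_group e n X\<^esub> 0" for e
    by (simp add: eps_homology_group_def eps_cycle_group_def eps_chain_group_def r_coset_def)
  have "0 \<in> eps_cycles \<mu> n X"
    by (simp add: eps_cycles_def eps_chain_zero)
  then show ?thesis
    unfolding one by (rule eps_homology_map_class [OF assms])
qed

text \<open>Preservation of the identity by the transition maps puts the identity of the product into
  the limit; without it the carrier of the limit could be empty.\<close>

lemma trivial_inverse_limit_group:
  assumes "\<And>i. i \<in> I \<Longrightarrow> trivial_group (G i)"
    and "\<And>i j. \<lbrakk>i \<in> I; j \<in> I; i \<le> j\<rbrakk> \<Longrightarrow> f i j \<one>\<^bsub>G i\<^esub> = \<one>\<^bsub>G j\<^esub>"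
  shows "trivial_group (inverse_limit_group I G f)"
proof -
  have triv: "trivial_group (product_group I G)"
    using assms(1) by (simp add: trivial_product_group)
  then have "carrier (product_group I G) = {\<one>\<^bsub>product_group I G\<^esub>}"
    by (simp add: trivial_group_def)
  then have "{x \<in> carrier (product_group I G). \<forall>i\<in>I. \<forall>j\<in>I. i \<le> j \<longrightarrow> f i j (x i) = x j}
      = carrier (product_group I G)"
    using assms(2) by auto
  then have "inverse_limit_group I G f = product_group I G"
    by (simp add: inverse_limit_group_def)
  then show ?thesis using triv by simp
qed

theorem theorem2p5:
  fixes X :: "'a metric" and pt :: 'a and n :: nat
  assumes "mspace X = {pt}"
    and "n > 0"
  shows "trivial_group (lc_homology_group n X)"
  unfolding lc_homology_group_def
  by (rule trivial_inverse_limit_group)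
     (simp_all add: trivial_eps_homology_group_singleton [OF assms(1) _ assms(2)]
       eps_homology_map_one)

end
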